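(* The value of $\mathrm{cdim}(G-v)-\mathrm{cdim}(G)$ can be arbitrarily large, as $G$ varies; that is, for every integer $N$ there exist a connected graph $G$ and a vertex $v$ of $G$ such that $G-v$ is connected and $\mathrm{cdim}(G-v)-\mathrm{cdim}(G)\ge N$.
   Context: All graphs are finite, simple, undirected, of order at least two. $G-v$ is the graph obtained by deleting the vertex $v$ and all edges incident to it. A set $S\subseteq V(G)$ is a resolving set of a connected graph $G$ if for every pair of distinct vertices $x,y$ of $G$ there is $z\in S$ with $d(x,z)\ne d(y,z)$ ($d$ is the shortest-path distance); it is a connected resolving set if moreover the induced subgraph $G[S]$ is connected. $\mathrm{cdim}(G)$ is the minimum cardinality of a connected resolving set of $G$. *)

theory Defs
  imports "Graph_Theory.Graph_Theory"
begin

text \<open>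
  A finite simple undirected graph is an instance of the locale \<^locale>\<open>graph\<close>, which encodes an
  undirected edge as a pair of opposite arcs. Connectedness is written with its theory name
  because \<^theory>\<open>HOL.Topological_Spaces\<close> has a constant of the same base name.
\<close>

text \<open>
  The minimal weight of a walk when every arc has weight 1, that is, the number of edges of
  a shortest path; it is infinite if there is no path.
\<close>
definition graph_dist :: "('a, 'b) pre_digraph \<Rightarrow> 'a \<Rightarrow> 'a \<Rightarrow> ereal" where
  "graph_dist G u v = wf_digraph.\<mu> G (\<lambda>_. 1) u v"

definition resolving_set :: "('a, 'b) pre_digraph \<Rightarrow> 'a set \<Rightarrow> bool" where
  "resolving_set G S \<longleftrightarrow> S \<subseteq> verts G \<and>
     (\<forall>x \<in> verts G. \<forall>y \<in> verts G. x \<noteq> y \<longrightarrow> (\<exists>z \<in> S. graph_dist G x z \<noteq> graph_dist G y z))"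

definition connected_resolving_set :: "('a, 'b) pre_digraph \<Rightarrow> 'a set \<Rightarrow> bool" where
  "connected_resolving_set G S \<longleftrightarrow>
     resolving_set G S \<and> Digraph_Component.connected (induce_subgraph G S)"

text \<open>
  Meaningful for finite connected graphs, where the minimum exists (see
  \<open>connected_resolving_set_verts\<close> below).
\<close>
definition cdim :: "('a, 'b) pre_digraph \<Rightarrow> nat" where
  "cdim G = (LEAST k. \<exists>S. connected_resolving_set G S \<and> card S = k)"

lemma graph_dist_eq_0_iff:
  assumes "graph G" "u \<in> verts G"
  shows "graph_dist G u v = 0 \<longleftrightarrow> u = v"
proof -
  interpret graph G by fact
  have cost: "awalk_cost (\<lambda>_. 1) p = real (length p)" for p
    by (induct p) auto
  have "u = v" if "graph_dist G u v = 0"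
  proof -
    have "u \<rightarrow>\<^sup>*\<^bsub>G\<^esub> v"
      using that unfolding graph_dist_def
      by (simp add: \<mu>_reach_conv[where f = "\<lambda>_. 1", symmetric])
    then obtain p where "apath u p v" "\<mu> (\<lambda>_. 1) u v = awalk_cost (\<lambda>_. 1) p"
      using min_cost_awalk[of u v "\<lambda>_. 1"] by auto
    then show "u = v" using that cost unfolding graph_dist_def
      by (auto simp: apath_def awalk_def)
  qed
  moreover have "graph_dist G v v = 0" if "u = v"
  proof -
    have "v \<rightarrow>\<^sup>*\<^bsub>G\<^esub> v" using that assms by auto
    then obtain p where p: "apath v p v" "\<mu> (\<lambda>_. 1) v v = awalk_cost (\<lambda>_. 1) p"
      using min_cost_awalk[of v v "\<lambda>_. 1"] by auto
    have "\<mu> (\<lambda>_. 1) v v \<le> awalk_cost (\<lambda>_. 1) []"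
      using that assms by (intro min_cost_le_walk_cost) (auto simp: awalk_Nil_iff)
    with p cost show ?thesis unfolding graph_dist_def by auto
  qed
  ultimately show ?thesis by auto
qed

lemma connected_resolving_set_verts:
  assumes "graph G" "Digraph_Component.connected G"
  shows "connected_resolving_set G (verts G)"
proof -
  interpret graph G by fact
  have "G \<restriction> verts G = G" by (rule pre_digraph.equality) auto
  then show ?thesis
    using assms graph_dist_eq_0_iff[OF assms(1)]
    unfolding connected_resolving_set_def resolving_set_def by (metis order_refl)
qed

end

theory Submission
  imports Defs
begin

text \<open>
  Two vertices with the same neighbours outside the pair (twins) are resolved only by
  themselves, so every resolving set contains one of them. Let $H$ be a path
  $1, 2, \<dots>, n - 1$ together with a twin $n$ of the end $1$ and a twin $n + 1$ of the end $n - 1$.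
  A connected resolving set of $H$ meets both twin pairs, and every vertex
  $2, \<dots>, n - 2$ of the path separates these pairs; hence it contains all of them, and
  $\mathrm{cdim}(H) \ge n - 3$ (\<open>cdim_open_path_ge\<close>).

  Let $G$ arise from $H$ by adding a vertex $0$ adjacent to $1$ and $n - 1$. The path becomes a
  cycle of length $n$, its former ends lie on both sides of $0$, and since only they are adjacent
  to $0$, they are no longer twins of $n$ and $n + 1$. The five consecutive cycle vertices $n - 2, n - 1, 0, 1, 2$ resolve $G$ when
  $n$ is even: distances to $0$ tell the cycle vertices apart up to reflection, the
  distance to $1$ decides the side, and the remaining confusions, between $2$ and $n$ and between
  $n - 2$ and $n + 1$, are settled because $2$ and $n - 2$ belong to the set
  (\<open>dist0_dist1_collision\<close>). So $\mathrm{cdim}(G) \le 5$ (\<open>cdim_closed_path_le\<close>), whereas deleting $0$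
  raises the value to at least $n - 3$.
\<close>

section \<open>Distances and connectedness\<close>

lemma (in wf_digraph) unit_awalk_cost: "awalk_cost (\<lambda>_. 1) p = real (length p)"
  by (induct p) auto

lemma (in wf_digraph) graph_dist_le_length:
  assumes "awalk u p v"
  shows "graph_dist G u v \<le> ereal (real (length p))"
  using min_cost_le_walk_cost[OF assms, of "\<lambda>_. 1"]
  by (simp add: graph_dist_def unit_awalk_cost)

lemma (in wf_digraph) le_graph_distI:
  assumes "\<And>p. awalk u p v \<Longrightarrow> c \<le> ereal (real (length p))"
  shows "c \<le> graph_dist G u v"
  using assms by (auto simp: graph_dist_def \<mu>_def unit_awalk_cost intro!: INF_greatest)

text \<open>
  A potential that changes by at most one along arcs bounds the length of every walk to \<open>s\<close> from
  below; following arcs of steepest descent gives a walk that attains the bound. This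
  reduces distance computations to local checks on arcs.
\<close>
lemma (in wf_digraph) graph_dist_eqI:
  fixes f :: "'a \<Rightarrow> nat"
  assumes root: "f s = 0"
    and lipschitz: "\<And>x y. x \<rightarrow>\<^bsub>G\<^esub> y \<Longrightarrow> f x \<le> Suc (f y)"
    and descent: "\<And>x. x \<in> verts G \<Longrightarrow> x \<noteq> s \<Longrightarrow> \<exists>y. x \<rightarrow>\<^bsub>G\<^esub> y \<and> f x = Suc (f y)"
    and "x \<in> verts G"
  shows "graph_dist G x s = ereal (real (f x))"
proof (rule antisym)
  have "\<exists>p. awalk x p s \<and> length p = f x"
    using \<open>x \<in> verts G\<close>
  proof (induction "f x" arbitrary: x rule: less_induct)
    case less
    show ?case
    proof (cases "x = s")
      case True
      then show ?thesis using root less.prems by (auto simp: awalk_Nil_iff)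
    next
      case False
      then obtain y where y: "x \<rightarrow>\<^bsub>G\<^esub> y" "f x = Suc (f y)" using descent less.prems by blast
      then obtain e where e: "e \<in> arcs G" "tail G e = x" "head G e = y"
        by (auto simp: arcs_ends_conv)
      obtain p where "awalk y p s" "length p = f y"
        using less.hyps[of y] y adj_in_verts by auto
      then show ?thesis using e y by (intro exI[of _ "e # p"]) (auto simp: awalk_Cons_iff)
    qed
  qed
  then show "graph_dist G x s \<le> ereal (real (f x))"
    using graph_dist_le_length by metis
  have "f x \<le> length p" if "awalk x p s" for p
    using that
  proof (induction p arbitrary: x)
    case Nil
    then show ?case using root by (auto simp: awalk_Nil_iff)
  next
    case (Cons e p)
    then have "f (head G e) \<le> length p" "x \<rightarrow>\<^bsub>G\<^esub> head G e"
      by (auto simp: awalk_Cons_iff intro: in_arcs_imp_in_arcs_ends)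
    then show ?case using lipschitz[of x "head G e"] by simp
  qed
  then show "ereal (real (f x)) \<le> graph_dist G x s"
    by (intro le_graph_distI) simp
qed

text \<open>
  The first step of a walk from \<open>u\<close> either goes to \<open>w\<close>, and dropping it leaves a shorter walk
  from \<open>w\<close>, or can be made from \<open>w\<close> instead. The target \<open>u\<close> is excluded because the walk may then
  be empty.
\<close>
lemma (in wf_digraph) graph_dist_le_if_dominates:
  assumes nbr: "\<And>y. u \<rightarrow>\<^bsub>G\<^esub> y \<Longrightarrow> y \<noteq> w \<Longrightarrow> w \<rightarrow>\<^bsub>G\<^esub> y" and "z \<noteq> u"
  shows "graph_dist G w z \<le> graph_dist G u z"
proof (rule le_graph_distI)
  fix p assume p: "awalk u p z"
  with \<open>z \<noteq> u\<close> obtain e q where [simp]: "p = e # q"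
    by (cases p) (auto simp: awalk_Nil_iff)
  from p have e: "e \<in> arcs G" "u = tail G e" and q: "awalk (head G e) q z"
    by (auto simp: awalk_Cons_iff)
  show "graph_dist G w z \<le> ereal (real (length p))"
  proof (cases "head G e = w")
    case True
    with q have "graph_dist G w z \<le> ereal (real (length q))" by (simp add: graph_dist_le_length)
    also have "\<dots> \<le> ereal (real (length p))" by simp
    finally show ?thesis .
  next
    case False
    with e have "w \<rightarrow>\<^bsub>G\<^esub> head G e" by (auto intro!: nbr in_arcs_imp_in_arcs_ends)
    then obtain e' where "e' \<in> arcs G" "tail G e' = w" "head G e' = head G e"
      by (auto simp: arcs_ends_conv)
    with q have "awalk w (e' # q) z" by (simp add: awalk_Cons_iff)
    from graph_dist_le_length[OF this] show ?thesis by simp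
  qed
qed

lemma (in wf_digraph) resolving_set_meets_twins:
  assumes "resolving_set G S" "u \<in> verts G" "w \<in> verts G" "u \<noteq> w"
    and "\<And>y. y \<noteq> u \<Longrightarrow> y \<noteq> w \<Longrightarrow> u \<rightarrow>\<^bsub>G\<^esub> y \<longleftrightarrow> w \<rightarrow>\<^bsub>G\<^esub> y"
    and "\<not> u \<rightarrow>\<^bsub>G\<^esub> u" "\<not> w \<rightarrow>\<^bsub>G\<^esub> w"
  shows "u \<in> S \<or> w \<in> S"
proof (rule ccontr)
  assume *: "\<not> ?thesis"
  from assms obtain z where "z \<in> S" "graph_dist G u z \<noteq> graph_dist G w z"
    unfolding resolving_set_def by blast
  moreover have "graph_dist G u z = graph_dist G w z"
    using * \<open>z \<in> S\<close> assms by (intro antisym graph_dist_le_if_dominates) metis+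
  ultimately show False by simp
qed

lemma (in sym_digraph) connectedI_descent:
  fixes f :: "'a \<Rightarrow> nat"
  assumes "r \<in> verts G"
    and "\<And>x. x \<in> verts G \<Longrightarrow> x \<noteq> r \<Longrightarrow> \<exists>y. x \<rightarrow>\<^bsub>G\<^esub> y \<and> f y < f x"
  shows "Digraph_Component.connected G"
proof -
  have "x \<rightarrow>\<^sup>*\<^bsub>G\<^esub> r" if "x \<in> verts G" for x
    using that
  proof (induction "f x" arbitrary: x rule: less_induct)
    case less
    then show ?case
      by (metis adj_in_verts(2) adj_reachable_trans assms(2) reachable_refl)
  qed
  then have "strongly_connected G"
    using \<open>r \<in> verts G\<close> by (intro strongly_connectedI) (auto intro: reachable_trans symmetric_reachable')
  then show ?thesis by (auto simp: connected_def strongly_connected_def intro: reachable_mk_symmetricI)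
qed

text \<open>
  Used in the contrapositive: a property that holds for one vertex, fails for another and is
  preserved by arcs exhibits a disconnection.
\<close>
lemma (in sym_digraph) connected_no_cut:
  assumes "Digraph_Component.connected G" "x \<in> verts G" "y \<in> verts G" "P x"
    and "\<And>a b. a \<rightarrow>\<^bsub>G\<^esub> b \<Longrightarrow> P a \<Longrightarrow> P b"
  shows "P y"
proof -
  have "x \<rightarrow>\<^sup>*\<^bsub>G\<^esub> y"
    using assms symmetric_connected_imp_strongly_connected[OF sym_arcs] by auto
  then show ?thesis by (induction rule: reachable_induct) (use assms in auto)
qed

section \<open>Graphs given by a relation\<close>

definition rel_graph :: "'a set \<Rightarrow> ('a \<Rightarrow> 'a \<Rightarrow> bool) \<Rightarrow> ('a, 'a \<times> 'a) pre_digraph" where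
  "rel_graph V E = \<lparr>verts = V, arcs = {(x, y). x \<in> V \<and> y \<in> V \<and> E x y}, tail = fst, head = snd\<rparr>"

lemma verts_rel_graph [simp]: "verts (rel_graph V E) = V"
  by (simp add: rel_graph_def)

lemma rel_graph_adj [simp]: "x \<rightarrow>\<^bsub>rel_graph V E\<^esub> y \<longleftrightarrow> x \<in> V \<and> y \<in> V \<and> E x y"
  by (force simp: rel_graph_def arcs_ends_conv)

lemma graph_rel_graph:
  assumes "finite V" "symp E" "irreflp E"
  shows "graph (rel_graph V E)"
proof
  show "finite (arcs (rel_graph V E))"
    by (rule finite_subset[of _ "V \<times> V"]) (use assms in \<open>auto simp: rel_graph_def\<close>)
  show "symmetric (rel_graph V E)"
    using assms by (auto simp: symmetric_def sym_def dest: sympD)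
qed (use assms in \<open>auto simp: rel_graph_def arc_to_ends_def dest: irreflpD\<close>)

lemma del_vert_rel_graph: "pre_digraph.del_vert (rel_graph V E) v = rel_graph (V - {v}) E"
  by (auto simp: pre_digraph.del_vert_def rel_graph_def)

lemma induce_rel_graph: "S \<subseteq> V \<Longrightarrow> rel_graph V E \<restriction> S = rel_graph S E"
  by (auto simp: induce_subgraph_def rel_graph_def)

section \<open>A path with twin ends, open and closed\<close>

text \<open>
  A cycle on \<open>0, \<dots>, n - 1\<close> with a triangle attached at each end of the path that is left without
  \<open>0\<close>. The twins \<open>n\<close> and \<open>n + 1\<close> are adjacent to their originals \<open>1\<close> and \<open>n - 1\<close>: distance \<open>1\<close> to \<open>1\<close>
  then separates \<open>n\<close> from every cycle vertex but \<open>0\<close> and \<open>2\<close>, and symmetrically for \<open>n + 1\<close>. Both the graph and its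
  vertex-deleted subgraph arise from this relation by choosing the vertex set.
\<close>
definition edge :: "nat \<Rightarrow> nat \<Rightarrow> nat \<Rightarrow> bool" where
  "edge n x y \<longleftrightarrow> y = Suc x \<and> y < n \<or> x = 0 \<and> Suc y = n
     \<or> x \<in> {1, 2} \<and> y = n \<or> n \<in> {x + 1, x + 2} \<and> y = Suc n"

definition adj :: "nat \<Rightarrow> nat \<Rightarrow> nat \<Rightarrow> bool" where
  "adj n x y \<longleftrightarrow> edge n x y \<or> edge n y x"

lemma graph_adj: "finite V \<Longrightarrow> 6 \<le> n \<Longrightarrow> graph (rel_graph V (adj n))"
  by (rule graph_rel_graph) (auto simp: adj_def edge_def symp_def irreflp_def)

text \<open>
  Distances to \<open>0\<close> and to \<open>1\<close> in the closed graph: the shorter way around the cycle, with separate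
  values at the twins.
\<close>
definition dist0 :: "nat \<Rightarrow> nat \<Rightarrow> nat" where
  "dist0 n x = (if n \<le> x then 2 else if 2 * x \<le> n then x else n - x)"

definition dist1 :: "nat \<Rightarrow> nat \<Rightarrow> nat" where
  "dist1 n x = (if x = 0 \<or> x = n then 1 else if x = Suc n then 3
     else if 2 * x \<le> n + 2 then x - 1 else Suc n - x)"

lemma graph_dist_0:
  assumes "6 \<le> n" "x \<le> Suc n"
  shows "graph_dist (rel_graph {..Suc n} (adj n)) x 0 = ereal (real (dist0 n x))"
proof -
  interpret graph "rel_graph {..Suc n} (adj n)" using assms by (intro graph_adj) auto
  let ?next = "\<lambda>x. if x = n then 1 else if x = Suc n then n - 1
    else if 2 * x \<le> n then x - 1 else if x = n - 1 then 0 else Suc x"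
  show ?thesis
  proof (rule graph_dist_eqI)
    show "dist0 n x \<le> Suc (dist0 n y)" if "x \<rightarrow>\<^bsub>rel_graph {..Suc n} (adj n)\<^esub> y" for x y
      using that \<open>6 \<le> n\<close> by (auto simp: adj_def edge_def dist0_def)
    show "\<exists>y. x \<rightarrow>\<^bsub>rel_graph {..Suc n} (adj n)\<^esub> y \<and> dist0 n x = Suc (dist0 n y)"
      if "x \<in> verts (rel_graph {..Suc n} (adj n))" "x \<noteq> 0" for x
      by (rule exI[of _ "?next x"])
        (use that \<open>6 \<le> n\<close> in \<open>auto simp: adj_def edge_def dist0_def\<close>)
  qed (use assms in \<open>auto simp: dist0_def\<close>)
qed

lemma graph_dist_1:
  assumes "6 \<le> n" "x \<le> Suc n"
  shows "graph_dist (rel_graph {..Suc n} (adj n)) x 1 = ereal (real (dist1 n x))"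
proof -
  interpret graph "rel_graph {..Suc n} (adj n)" using assms by (intro graph_adj) auto
  show ?thesis
  proof (rule graph_dist_eqI)
    show "dist1 n x \<le> Suc (dist1 n y)" if "x \<rightarrow>\<^bsub>rel_graph {..Suc n} (adj n)\<^esub> y" for x y
      using that \<open>6 \<le> n\<close> by (auto simp: adj_def edge_def dist1_def)
    show "\<exists>y. x \<rightarrow>\<^bsub>rel_graph {..Suc n} (adj n)\<^esub> y \<and> dist1 n x = Suc (dist1 n y)"
      if "x \<in> verts (rel_graph {..Suc n} (adj n))" "x \<noteq> 1" for x
    proof -
      from that consider "x = 0 \<or> x = n" | "x = Suc n" | "2 \<le> x" "x < n" "2 * x \<le> n + 2"
        | "n + 2 < 2 * x" "x + 1 < n" | "n + 2 < 2 * x" "x + 1 = n"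
        by fastforce
      then show ?thesis
      proof cases
        case 1
        then show ?thesis using \<open>6 \<le> n\<close>
          by (intro exI[of _ 1]) (auto simp: adj_def edge_def dist1_def)
      next
        case 2
        then show ?thesis using \<open>6 \<le> n\<close>
          by (intro exI[of _ "n - 1"]) (auto simp: adj_def edge_def dist1_def)
      next
        case 3
        then show ?thesis using \<open>6 \<le> n\<close>
          by (intro exI[of _ "x - 1"]) (auto simp: adj_def edge_def dist1_def)
      next
        case 4
        then show ?thesis using \<open>6 \<le> n\<close>
          by (intro exI[of _ "Suc x"]) (auto simp: adj_def edge_def dist1_def)
      next
        case 5
        then show ?thesis using \<open>6 \<le> n\<close>
          by (intro exI[of _ 0]) (auto simp: adj_def edge_def dist1_def)
      qed
    qed
  qed (use assms in \<open>auto simp: dist1_def\<close>)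
qed

text \<open>
  On an even cycle, the distance to \<open>1\<close> minus that to \<open>0\<close> is \<open>-1\<close> at \<open>1, \<dots>, n div 2\<close> and \<open>1\<close> at
  all other cycle vertices, so together with the distance to \<open>0\<close> it determines a cycle vertex. Only the twins collide
  with a cycle vertex, namely \<open>n\<close> with \<open>2\<close> and \<open>n + 1\<close> with \<open>n - 2\<close>.
\<close>
lemma dist0_dist1_collision:
  assumes "6 \<le> n" "even n" "x < y" "y \<le> Suc n" "dist0 n x = dist0 n y" "dist1 n x = dist1 n y"
  shows "x \<in> {2, n - 2}"
  using assms by (auto simp: dist0_def dist1_def split: if_splits elim!: evenE)

lemma cdim_closed_path_le:
  assumes "6 \<le> n" "even n"
  shows "cdim (rel_graph {..Suc n} (adj n)) \<le> 5"
proof -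
  let ?G = "rel_graph {..Suc n} (adj n)"
  define S where "S = {n - 2, n - 1, 0, 1, 2}"
  interpret S: graph "rel_graph S (adj n)" by (rule graph_adj) (use assms in \<open>auto simp: S_def\<close>)
  have G: "graph ?G" using assms by (intro graph_adj) auto
  have sub: "S \<subseteq> {..Suc n}" using assms by (auto simp: S_def)
  have coll: "x \<in> S" if "x < y" "y \<le> Suc n" "graph_dist ?G x 0 = graph_dist ?G y 0"
    "graph_dist ?G x 1 = graph_dist ?G y 1" for x y
    using dist0_dist1_collision[of n x y] that assms graph_dist_1[of n x] graph_dist_1[of n y]
    by (simp add: graph_dist_0 S_def) auto
  have "\<exists>z\<in>S. graph_dist ?G x z \<noteq> graph_dist ?G y z"
    if "x < y" "y \<le> Suc n" for x y
  proof (rule ccontr)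
    assume *: "\<not> ?thesis"
    \<comment> \<open>The only candidate pairs have their smaller member in \<open>S\<close>, and a vertex resolves itself from
      every other one.\<close>
    then have "x \<in> S" using that by (intro coll[of x y]) (auto simp: S_def)
    with * have "graph_dist ?G x x = graph_dist ?G y x" by blast
    then show False
      using that graph_dist_eq_0_iff[OF G, of x x] graph_dist_eq_0_iff[OF G, of y x] by auto
  qed
  then have "resolving_set ?G S"
    unfolding resolving_set_def using sub by (auto simp: neq_iff) metis
  moreover have "Digraph_Component.connected (rel_graph S (adj n))"
  proof (rule S.connectedI_descent[where f = "dist0 n"])
    show "0 \<in> verts (rel_graph S (adj n))" by (simp add: S_def)
    show "\<exists>y. x \<rightarrow>\<^bsub>rel_graph S (adj n)\<^esub> y \<and> dist0 n y < dist0 n x"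
      if "x \<in> verts (rel_graph S (adj n))" "x \<noteq> 0" for x
    proof -
      obtain m where m: "n = Suc (Suc m)" using assms by (intro that[of "n - 2"]) simp
      from that m consider "x = m" | "x = Suc m" | "x = 1" | "x = 2" by (auto simp: S_def)
      then show ?thesis
      proof cases
        case 1
        then show ?thesis using assms m
          by (intro exI[of _ "Suc m"]) (auto simp: S_def adj_def edge_def dist0_def)
      next
        case 2
        then show ?thesis using assms m
          by (intro exI[of _ 0]) (auto simp: S_def adj_def edge_def dist0_def)
      next
        case 3
        then show ?thesis using assms m
          by (intro exI[of _ 0]) (auto simp: S_def adj_def edge_def dist0_def)
      next
        case 4
        then show ?thesis using assms m
          by (intro exI[of _ 1]) (auto simp: S_def adj_def edge_def dist0_def)
      qed
    qed
  qed
  ultimately have "connected_resolving_set ?G S"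
    using sub by (simp add: connected_resolving_set_def induce_rel_graph)
  then have "cdim ?G \<le> card S" unfolding cdim_def by (intro Least_le) blast
  also have "\<dots> \<le> 5" unfolding S_def by (simp add: card_insert_if)
  finally show ?thesis .
qed

lemma cdim_open_path_ge:
  assumes "6 \<le> n" and conn: "Digraph_Component.connected (rel_graph {1..Suc n} (adj n))"
  shows "n - 3 \<le> cdim (rel_graph {1..Suc n} (adj n))"
proof -
  let ?G = "rel_graph {1..Suc n} (adj n)"
  interpret G: graph ?G using assms by (intro graph_adj) auto
  have "n - 3 \<le> card S" if S: "connected_resolving_set ?G S" for S
  proof -
    have res: "resolving_set ?G S" and sub: "S \<subseteq> {1..Suc n}"
      using S by (auto simp: connected_resolving_set_def resolving_set_def)
    have conS: "Digraph_Component.connected (rel_graph S (adj n))"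
      using S sub by (simp add: connected_resolving_set_def induce_rel_graph)
    have fin: "finite S" using sub finite_subset by blast
    interpret S: graph "rel_graph S (adj n)" using assms fin by (intro graph_adj)
    have "1 \<in> S \<or> n \<in> S"
      by (rule G.resolving_set_meets_twins[OF res])
        (use assms in \<open>auto simp: adj_def edge_def\<close>)
    then obtain a where a: "a \<in> S" "a = 1 \<or> a = n" by blast
    obtain m where m: "n = Suc m" using assms by (cases n) auto
    have "m \<in> S \<or> Suc n \<in> S"
      by (rule G.resolving_set_meets_twins[OF res])
        (use assms m in \<open>auto simp: adj_def edge_def\<close>)
    then obtain b where b: "b \<in> S" "b = n - 1 \<or> b = Suc n" using m by auto
    have "k \<in> S" if k: "2 \<le> k" "k \<le> n - 2" for k
    proof (rule ccontr)
      assume "k \<notin> S"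
      \<comment> \<open>Without \<open>k\<close>, the part of the path before \<open>k\<close> together with the left twin is closed
        under arcs.\<close>
      have "b < k \<or> b = n"
      proof (rule S.connected_no_cut[OF conS, of a b])
        show "y < k \<or> y = n" if "x \<rightarrow>\<^bsub>rel_graph S (adj n)\<^esub> y" "x < k \<or> x = n" for x y
        proof -
          have "x \<noteq> k" "y \<noteq> k" "x \<noteq> 0" "y \<noteq> 0" using that \<open>k \<notin> S\<close> sub by auto
          with that k assms show ?thesis by (auto simp: adj_def edge_def)
        qed
      qed (use a b k in auto)
      with b k assms show False by auto
    qed
    then have "{2..n - 2} \<subseteq> S" by auto
    from card_mono[OF fin this] show ?thesis by simp
  qed
  moreover have "\<exists>S. connected_resolving_set ?G S \<and> card S = cdim ?G"
    unfolding cdim_def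
    by (rule LeastI_ex) (use connected_resolving_set_verts[OF G.graph_axioms conn] in blast)
  ultimately show ?thesis by metis
qed

theorem mainTheorem18:
  fixes N :: int
  shows "\<exists>(G :: (nat, nat \<times> nat) pre_digraph) v.
    graph G \<and> card (verts G) \<ge> 2 \<and> Digraph_Component.connected G \<and>
    v \<in> verts G \<and>
    card (verts (pre_digraph.del_vert G v)) \<ge> 2 \<and>
    Digraph_Component.connected (pre_digraph.del_vert G v) \<and>
    int (cdim (pre_digraph.del_vert G v)) - int (cdim G) \<ge> N"
proof -
  \<comment> \<open>The gap is at least \<open>(n - 3) - 5\<close>, and \<open>n\<close> must be even.\<close>
  define n where "n = 2 * (nat N + 4)"
  have n: "6 \<le> n" "even n" by (auto simp: n_def)
  let ?G = "rel_graph {..Suc n} (adj n)" and ?H = "rel_graph {1..Suc n} (adj n)"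
  interpret G: graph ?G using n by (intro graph_adj) auto
  interpret H: graph ?H using n by (intro graph_adj) auto
  have "{..Suc n} - {0} = {1..Suc n}" by auto
  then have del: "pre_digraph.del_vert ?G 0 = ?H"
    by (simp add: del_vert_rel_graph)
  have connG: "Digraph_Component.connected ?G"
    by (rule G.connectedI_descent[of 0 id], simp,
      rule_tac x = "if x = n then 1 else if x = Suc n then n - 1 else x - 1" in exI)
      (use n in \<open>auto simp: adj_def edge_def\<close>)
  have connH: "Digraph_Component.connected ?H"
    by (rule H.connectedI_descent[of 1 id], simp,
      rule_tac x = "if x = n then 1 else if x = Suc n then n - 1 else x - 1" in exI)
      (use n in \<open>auto simp: adj_def edge_def\<close>)
  have "N \<le> int (cdim ?H) - int (cdim ?G)"
    using cdim_closed_path_le[OF n] cdim_open_path_ge[OF n(1) connH] by (simp add: n_def)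
  then show ?thesis
    using G.graph_axioms connG connH n by (intro exI[of _ ?G] exI[of _ 0]) (simp add: del)
qed

end
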